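(* Let $k\in\mathbb{N}_0$. (Charlier) Let $\mu>0$ and $\Phi_k(z)=(-1)^k\varphi_C(z)$, where $\varphi_C(z)=\dfrac{e^{\mu}}{\Gamma(-z)}$. Then $$z\,\Phi_k(z-1)+\Phi_k(z)=0\qquad\text{for all } z\in\mathbb{C}.$$ Moreover, the entire functions $F$ satisfying $z\,F(z-1)+F(z)=0$ for all $z\in\mathbb{C}$ are precisely the functions $$F(z)=\frac{p(z)}{\Gamma(-z)},$$ where $p$ is an arbitrary one-periodic entire function. (Meixner) Let $\gamma>0$, $0<\mu<1$ and $\Phi_k(z)=(-1)^k\varphi_M(z)$, where $\varphi_M(z)=\dfrac{1}{(1-\mu)^{\gamma+z}\,\Gamma(-z)}$. Then $$z\,\Phi_k(z-1)+(1-\mu)\,\Phi_k(z)=0\qquad\text{for all } z\in\mathbb{C}.$$ Moreover, the entire functions $F$ satisfying $z\,F(z-1)+(1-\mu)F(z)=0$ for all $z\in\mathbb{C}$ are precisely the functions $$F(z)=\frac{p(z)\,(1-\mu)^{-z}}{\Gamma(-z)},$$ where $p$ is an arbitrary one-periodic entire function.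
   Context: $\mathbb{N}_0=\{0,1,2,\dots\}$. $1/\Gamma$ denotes the entire reciprocal Gamma function (equal to $0$ at nonpositive integers), so $\varphi_C$ and $\varphi_M$ are entire. The power $(1-\mu)^{z}$ is the entire function $\exp(z\log(1-\mu))$ with $\log(1-\mu)$ the real logarithm of the positive number $1-\mu$. A function $p$ is one-periodic if $p(z+1)=p(z)$ for all $z\in\mathbb{C}$. In the source, $\Phi_k$ arises as the common limit of normalised $k$th-order forward differences of the (mass-modified) monic Charlier, respectively Meixner, polynomials; here it is given by its explicit formula. *)

theory Defs
  imports "HOL-Complex_Analysis.Complex_Analysis"
begin

definition entire :: "(complex \<Rightarrow> complex) \<Rightarrow> bool" where
  "entire f \<longleftrightarrow> f holomorphic_on UNIV"

definition one_periodic :: "(complex \<Rightarrow> complex) \<Rightarrow> bool" where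
  "one_periodic p \<longleftrightarrow> (\<forall>z. p (z + 1) = p z)"

text \<open>
  The library function \<^const>\<open>rGamma\<close> is the entire function $1/\Gamma$, with zeros at the
  nonpositive integers. For real $\mu < 1$, the complex power of the positive real $1 - \mu$
  is $\exp (z \log (1 - \mu))$ with the real logarithm, since the principal branch
  is real on the positive half-line.
\<close>

definition phi_charlier :: "real \<Rightarrow> complex \<Rightarrow> complex" where
  "phi_charlier \<mu> z = of_real (exp \<mu>) * rGamma (- z)"

definition phi_meixner :: "real \<Rightarrow> real \<Rightarrow> complex \<Rightarrow> complex" where
  "phi_meixner \<gamma> \<mu> z = rGamma (- z) / of_real (1 - \<mu>) powr (of_real \<gamma> + z)"

definition Phi_charlier :: "nat \<Rightarrow> real \<Rightarrow> complex \<Rightarrow> complex" where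
  "Phi_charlier k \<mu> z = (- 1) ^ k * phi_charlier \<mu> z"

definition Phi_meixner :: "nat \<Rightarrow> real \<Rightarrow> real \<Rightarrow> complex \<Rightarrow> complex" where
  "Phi_meixner k \<gamma> \<mu> z = (- 1) ^ k * phi_meixner \<gamma> \<mu> z"

end

theory Submission
  imports Defs
begin

text \<open>
  Both equations have the form \<open>z F(z - 1) + c F(z) = 0\<close> with \<open>c \<noteq> 0\<close> (\<open>c = 1\<close> for Charlier,
  \<open>c = 1 - \<mu>\<close> for Meixner), and the functional equation of the reciprocal Gamma function makes
  \<open>E(z) = c\<^sup>-\<^sup>z / \<Gamma>(- z)\<close> an entire solution (\<open>solution_iff\<close>, \<open>base_solution\<close>).

  The quotient \<open>F / E\<close> of any solution \<open>F\<close> by \<open>E\<close> is formally one-periodic, but \<open>E\<close> vanishes at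
  the nonnegative integers. Rather than showing that the singularities of the quotient there are
  removable, one may stay in the half-plane \<open>Re z < 0\<close>, where \<open>E\<close> has no zeros: the quotient is
  holomorphic and periodic there, and periodicity alone continues it to an entire function \<open>p\<close>
  by translating each point far enough to the left (\<open>periodic_extension\<close>). Both \<open>F\<close> and \<open>p E\<close>
  solve the equation and agree on the half-plane; since \<open>c \<noteq> 0\<close>, the equation recovers \<open>F(z)\<close>
  from \<open>F(z - 1)\<close>, so that they agree everywhere (\<open>solution_determined_on_left_half_plane\<close>).
\<close>

lemma periodic_shift_left:
  assumes per: "\<And>z. Re z < 0 \<Longrightarrow> q (z - 1) = q z"
    and "Re z < 0"
  shows "q (z - of_nat n) = q z"
proof (induction n)
  case (Suc n)
  have "q (z - of_nat n - 1) = q (z - of_nat n)"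
    using \<open>Re z < 0\<close> by (intro per) auto
  with Suc show ?case by (simp add: algebra_simps)
qed simp

text \<open>
  The value at \<open>z\<close> is that of \<open>q\<close> at any translate \<open>z - n\<close> in the half-plane. The translate can be
  chosen uniformly for \<open>Re z < m\<close>, and these half-planes exhaust the plane, so holomorphy is
  inherited from \<open>q\<close>.
\<close>
lemma periodic_extension:
  assumes hol: "q holomorphic_on {z. Re z < 0}"
    and per: "\<And>z. Re z < 0 \<Longrightarrow> q (z - 1) = q z"
  obtains p where "entire p" "one_periodic p" "\<And>z. Re z < 0 \<Longrightarrow> p z = q z"
proof
  define N where "N z = nat (\<lceil>Re z\<rceil> + 1)" for z :: complex
  define p where "p z = q (z - of_nat (N z))" for z
  have N: "Re z < real (N z)" for z
    unfolding N_def by linarith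
  have p_eq: "p z = q (z - of_nat m)" if "Re z < real m" for z m
  proof -
    \<comment> \<open>Both translates are compared with the one by the sum of the two shifts.\<close>
    have "q (z - of_nat (N z) - of_nat m) = p z"
      unfolding p_def using N[of z] by (intro periodic_shift_left per) auto
    moreover have "q (z - of_nat m - of_nat (N z)) = q (z - of_nat m)"
      using that by (intro periodic_shift_left per) auto
    ultimately show ?thesis by (simp add: algebra_simps)
  qed
  show "p z = q z" if "Re z < 0" for z
    using p_eq[of z 0] that by simp
  show "one_periodic p"
    unfolding one_periodic_def
  proof
    fix z
    have "p (z + 1) = q (z + 1 - of_nat (Suc (N z)))"
      using N[of z] by (intro p_eq) auto
    then show "p (z + 1) = p z"
      by (simp add: p_def)
  qed
  have "p holomorphic_on (\<Union>m. {z. Re z < real m})"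
  proof (rule holomorphic_on_UN_open)
    fix m :: nat
    have "(q \<circ> (\<lambda>z. z - of_nat m)) holomorphic_on {z. Re z < real m}"
      by (rule holomorphic_on_compose_gen[OF _ hol]) (auto intro!: holomorphic_intros)
    then show "p holomorphic_on {z. Re z < real m}"
      by (rule holomorphic_transform) (simp add: p_eq)
  qed (simp add: open_halfspace_Re_lt)
  moreover have "(\<Union>m. {z. Re z < real m}) = UNIV"
    using N by blast
  ultimately show "entire p"
    by (simp add: entire_def)
qed

lemma solution_determined_on_left_half_plane:
  fixes c :: complex
  assumes "c \<noteq> 0"
    and F: "\<And>z. z * F (z - 1) + c * F z = 0"
    and G: "\<And>z. z * G (z - 1) + c * G z = 0"
    and agree: "\<And>z. Re z < 0 \<Longrightarrow> F z = G z"
  shows "F z = G z"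
proof -
  have "F z = G z" if "Re z < real n" for n z
    using that
  proof (induction n arbitrary: z)
    case 0
    then show ?case using agree by simp
  next
    case (Suc n)
    then have "F (z - 1) = G (z - 1)" by simp
    then have "c * F z = c * G z"
      using F[of z] G[of z] by (metis add_left_cancel)
    then show ?case using \<open>c \<noteq> 0\<close> by simp
  qed
  moreover obtain n where "Re z < real n"
    using reals_Archimedean2 by blast
  ultimately show ?thesis by blast
qed

lemma solution_times_periodic:
  fixes c :: complex
  assumes "one_periodic p" and "z * E (z - 1) + c * E z = 0"
  shows "z * (p (z - 1) * E (z - 1)) + c * (p z * E z) = 0"
proof -
  have "p (z - 1) = p z"
    using assms(1) by (metis one_periodic_def diff_add_cancel)
  then have "z * (p (z - 1) * E (z - 1)) + c * (p z * E z) = p z * (z * E (z - 1) + c * E z)"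
    by (simp add: algebra_simps)
  with assms(2) show ?thesis by simp
qed

text \<open>
  The equation has order one, so a single solution that is free of zeros on a left half-plane
  generates all of them over the ring of one-periodic entire functions.
\<close>
lemma solution_iff:
  fixes c :: complex
  assumes "c \<noteq> 0" and E: "entire E" "\<And>z. z * E (z - 1) + c * E z = 0"
    and nz: "\<And>z. Re z < 0 \<Longrightarrow> E z \<noteq> 0"
  shows "entire F \<and> (\<forall>z. z * F (z - 1) + c * F z = 0) \<longleftrightarrow>
    (\<exists>p. F = (\<lambda>z. p z * E z) \<and> entire p \<and> one_periodic p)"
proof safe
  assume F: "entire F" "\<forall>z. z * F (z - 1) + c * F z = 0"
  have hol: "(\<lambda>z. F z / E z) holomorphic_on {z. Re z < 0}"
    using F(1) E(1) nz unfolding entire_def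
    by (intro holomorphic_on_divide) (auto intro: holomorphic_on_subset)
  have per: "F (z - 1) / E (z - 1) = F z / E z" if "Re z < 0" for z
  proof -
    have "z \<noteq> 0" using that by auto
    have step: "f (z - 1) = - c / z * f z" if "z * f (z - 1) + c * f z = 0" for f
      using that \<open>z \<noteq> 0\<close> by (simp add: field_simps eq_neg_iff_add_eq_0)
    show ?thesis
      using step[OF E(2)] step[of F] F(2) \<open>c \<noteq> 0\<close> \<open>z \<noteq> 0\<close> by simp
  qed
  obtain p where p: "entire p" "one_periodic p"
      and eq: "\<And>z. Re z < 0 \<Longrightarrow> p z = F z / E z"
    using periodic_extension[OF hol per] by blast
  have "F z = p z * E z" for z
  proof (rule solution_determined_on_left_half_plane[where F = F and G = "\<lambda>z. p z * E z",
        OF \<open>c \<noteq> 0\<close>])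
    show "w * F (w - 1) + c * F w = 0" for w
      using F(2) by blast
    show "w * (p (w - 1) * E (w - 1)) + c * (p w * E w) = 0" for w
      by (rule solution_times_periodic[OF p(2) E(2)])
    show "F w = p w * E w" if "Re w < 0" for w
      using eq[OF that] nz[OF that] by simp
  qed
  with p show "\<exists>p. F = (\<lambda>z. p z * E z) \<and> entire p \<and> one_periodic p"
    by blast
next
  fix p assume "entire p" "one_periodic p"
  then show "entire (\<lambda>z. p z * E z)"
    using E(1) by (auto simp: entire_def intro: holomorphic_intros)
  show "z * (p (z - 1) * E (z - 1)) + c * (p z * E z) = 0" for z
    by (rule solution_times_periodic[OF \<open>one_periodic p\<close> E(2)])
qed

text \<open>This is \<open>1 / \<Gamma>(w) = w / \<Gamma>(w + 1)\<close> at \<open>w = - z\<close>.\<close>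
lemma rGamma_difference: "z * rGamma (- (z - 1)) + rGamma (- z) = (0 :: complex)"
  using rGamma_plus1[of "- z"] by (simp add: neg_eq_iff_add_eq_0)

lemma base_solution:
  fixes c :: complex
  assumes "c \<noteq> 0"
  defines "E \<equiv> \<lambda>z. c powr (- z) * rGamma (- z)"
  shows "entire E" "z * E (z - 1) + c * E z = 0" "Re z < 0 \<Longrightarrow> E z \<noteq> 0"
proof -
  show "entire E"
    using \<open>c \<noteq> 0\<close> unfolding entire_def E_def powr_def by (auto intro!: holomorphic_intros)
  have "c powr (- (z - 1)) = c * c powr (- z)"
    using \<open>c \<noteq> 0\<close> powr_add[of c 1 "- z"] by simp
  then have "z * E (z - 1) + c * E z = c * c powr (- z) * (z * rGamma (- (z - 1)) + rGamma (- z))"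
    unfolding E_def by (simp add: algebra_simps)
  then show "z * E (z - 1) + c * E z = 0"
    by (simp only: rGamma_difference mult_zero_right)
  show "E z \<noteq> 0" if "Re z < 0"
    using that \<open>c \<noteq> 0\<close> by (auto simp: E_def rGamma_eq_zero_iff elim!: nonpos_Ints_cases')
qed

lemma solutions_eq:
  fixes c :: complex
  assumes "c \<noteq> 0"
  shows "{F. entire F \<and> (\<forall>z. z * F (z - 1) + c * F z = 0)} =
    {(\<lambda>z. p z * c powr (- z) * rGamma (- z)) | p. entire p \<and> one_periodic p}"
  using solution_iff[OF assms base_solution[OF assms]] by (simp add: mult.assoc)

lemma Phi_charlier_equation: "z * Phi_charlier k \<mu> (z - 1) + Phi_charlier k \<mu> z = 0"
proof -
  have "z * Phi_charlier k \<mu> (z - 1) + Phi_charlier k \<mu> z =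
      (- 1) ^ k * of_real (exp \<mu>) * (z * rGamma (- (z - 1)) + rGamma (- z))"
    unfolding Phi_charlier_def phi_charlier_def by (simp add: algebra_simps)
  then show ?thesis
    by (simp only: rGamma_difference mult_zero_right)
qed

text \<open>
  Up to the constant \<open>(- 1)\<^sup>k (1 - \<mu>)\<^sup>-\<^sup>\<gamma>\<close> this is the solution of \<open>base_solution\<close>.
\<close>
lemma Phi_meixner_equation:
  assumes "\<mu> < 1"
  shows "z * Phi_meixner k \<gamma> \<mu> (z - 1) + of_real (1 - \<mu>) * Phi_meixner k \<gamma> \<mu> z = 0"
proof -
  define c where "c = complex_of_real (1 - \<mu>)"
  define A where "A = (- 1) ^ k * c powr (- of_real \<gamma>)"
  have "c \<noteq> 0" using assms by (simp add: c_def del: of_real_diff)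
  have Phi: "Phi_meixner k \<gamma> \<mu> w = A * (c powr (- w) * rGamma (- w))" for w
    using \<open>c \<noteq> 0\<close>
    by (simp add: Phi_meixner_def phi_meixner_def A_def c_def[symmetric] powr_add powr_minus
        field_simps del: of_real_diff)
  have "z * (A * (c powr (- (z - 1)) * rGamma (- (z - 1)))) + c * (A * (c powr (- z) * rGamma (- z)))
      = A * (z * (c powr (- (z - 1)) * rGamma (- (z - 1))) + c * (c powr (- z) * rGamma (- z)))"
    by (simp only: distrib_left mult.left_commute)
  then show ?thesis
    by (simp only: Phi c_def[symmetric] base_solution(2)[OF \<open>c \<noteq> 0\<close>] mult_zero_right)
qed

theorem theorem5p1:
  fixes k :: nat
  shows
    "(\<forall>\<mu>::real. \<mu> > 0 \<longrightarrow>
        (\<forall>z. z * Phi_charlier k \<mu> (z - 1) + Phi_charlier k \<mu> z = 0) \<and>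
        {F. entire F \<and> (\<forall>z. z * F (z - 1) + F z = 0)} =
          {(\<lambda>z. p z * rGamma (- z)) | p. entire p \<and> one_periodic p}) \<and>
     (\<forall>\<gamma> \<mu>::real. \<gamma> > 0 \<and> 0 < \<mu> \<and> \<mu> < 1 \<longrightarrow>
        (\<forall>z. z * Phi_meixner k \<gamma> \<mu> (z - 1) + of_real (1 - \<mu>) * Phi_meixner k \<gamma> \<mu> z = 0) \<and>
        {F. entire F \<and> (\<forall>z. z * F (z - 1) + of_real (1 - \<mu>) * F z = 0)} =
          {(\<lambda>z. p z * of_real (1 - \<mu>) powr (- z) * rGamma (- z)) | p. entire p \<and> one_periodic p})"
proof (intro conjI allI impI; (elim conjE)?)
  fix \<mu> :: real and z
  show "z * Phi_charlier k \<mu> (z - 1) + Phi_charlier k \<mu> z = 0"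
    by (rule Phi_charlier_equation)
next
  show "{F. entire F \<and> (\<forall>z. z * F (z - 1) + F z = 0)} =
      {(\<lambda>z. p z * rGamma (- z)) | p. entire p \<and> one_periodic p}"
    using solutions_eq[of 1] by simp
next
  fix \<gamma> \<mu> :: real and z
  assume "\<mu> < 1"
  then show "z * Phi_meixner k \<gamma> \<mu> (z - 1) + of_real (1 - \<mu>) * Phi_meixner k \<gamma> \<mu> z = 0"
    by (rule Phi_meixner_equation)
next
  fix \<gamma> \<mu> :: real
  assume "\<mu> < 1"
  then have "complex_of_real (1 - \<mu>) \<noteq> 0"
    by (simp del: of_real_diff)
  then show "{F. entire F \<and> (\<forall>z. z * F (z - 1) + of_real (1 - \<mu>) * F z = 0)} =
      {(\<lambda>z. p z * of_real (1 - \<mu>) powr (- z) * rGamma (- z)) | p. entire p \<and> one_periodic p}"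
    by (rule solutions_eq)
qed

end
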